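(* Let $(X,\|\cdot\|_X)$ and $(Y,\|\cdot\|_Y)$ be real Banach spaces with $X$ uniformly convex and compactly embedded into $Y$, let $p>1$ and $q>1$ be real numbers, and let $A:X\to X^\star$ and $B:Y\to Y^\star$ be continuous maps satisfying hypotheses (A1), (A2), (B1), (B2), (AB) listed in the context. Let $$\mu:=\inf\{\|w\|_X^p : w\in X,\ \|w\|_Y=1\},$$ and let $\{w_n\}_{n\in\mathbb{N}}\subset X$ be a minimizing sequence, that is, $\|w_n\|_Y=1$ for all $n$ and $\|w_n\|_X^p\to\mu$. Then there exists a subsequence $\{w_{n_j}\}_{j\in\mathbb{N}}$ converging weakly in $X$ to a vector $w\in X$ with $\|w\|_Y=1$ and $\|w\|_X^p=\mu$. Moreover, $\mu$ is an eigenvalue of $$A(w)=\lambda\|w\|_Y^{p-q}B(w),$$ and the eigenvectors corresponding to $\mu$ are precisely the nonzero scalar multiples of those vectors $w\in X$ with $\|w\|_Y=1$ and $\|w\|_X^p=\mu$.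
   Context: $X^\star,Y^\star$ are the topological dual spaces, and $\langle f,v\rangle:=f(v)$. "Compactly embedded" means that $X$ is a linear subspace of $Y$ and the inclusion $X\hookrightarrow Y$ is a compact linear operator (in particular continuous). Hypotheses: (A1) $A(tw)=|t|^{p-2}t\,A(w)$ for all $t\in\mathbb{R}$, $w\in X$. (A2) $\langle A(u),v\rangle\le\|u\|_X^{p-1}\|v\|_X$ for all $u,v\in X$, with equality if and only if either $u=0$ or $v=0$ or $u=tv$ for some $t>0$. (B1) $B(tw)=|t|^{q-2}t\,B(w)$ for all $t\in\mathbb{R}$, $w\in Y$. (B2) $\langle B(u),v\rangle\le\|u\|_Y^{q-1}\|v\|_Y$ for all $u,v\in Y$, with equality whenever $u=tv$ for some $t\ge 0$. (AB) For each $w\in Y\setminus\{0\}$ there exists at least one $u\in X\setminus\{0\}$ such that $\langle A(u),v\rangle=\langle B(w),v\rangle$ for all $v\in X$. (Here $|t|^{p-2}t$ and $|t|^{q-2}t$ are $0$ at $t=0$.) Eigenpairs: $\lambda\in\mathbb{R}$ is an eigenvalue of $A(w)=\lambda\|w\|_Y^{p-q}B(w)$, with corresponding eigenvector $w\in X\setminus\{0\}$, if $\langle A(w),v\rangle=\lambda\|w\|_Y^{p-q}\langle B(w),v\rangle$ for all $v\in X$. *)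

theory Defs
  imports "HOL-Analysis.Analysis"
begin

definition uniformly_convex :: "'a::real_normed_vector itself \<Rightarrow> bool" where
  "uniformly_convex (_ :: 'a itself) \<longleftrightarrow>
     (\<forall>e. 0 < e \<and> e \<le> 2 \<longrightarrow>
        (\<exists>d>0. \<forall>x y :: 'a. norm x = 1 \<and> norm y = 1 \<and> e \<le> norm (x - y)
            \<longrightarrow> norm ((1/2) *\<^sub>R (x + y)) \<le> 1 - d))"

definition compact_operator :: "('a::real_normed_vector \<Rightarrow> 'b::real_normed_vector) \<Rightarrow> bool" where
  "compact_operator T \<longleftrightarrow>
     bounded_linear T \<and> (\<forall>S. bounded S \<longrightarrow> compact (closure (T ` S)))"

text \<open>
  The subspace \<open>X\<close> of \<open>Y\<close> carries its own norm, so it is a type of its own, and the inclusion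
  into \<open>Y\<close> is an injective linear map \<open>\<iota>\<close>. Thus \<open>norm (\<iota> w)\<close> is the \<open>Y\<close>-norm of \<open>w\<close>.
  The topological dual of a space \<open>'a\<close> is the normed space \<open>'a \<Rightarrow>\<^sub>L real\<close>.
\<close>

definition compact_embedding :: "('a::real_normed_vector \<Rightarrow> 'b::real_normed_vector) \<Rightarrow> bool" where
  "compact_embedding \<iota> \<longleftrightarrow> inj \<iota> \<and> compact_operator \<iota>"

definition weakly_converges :: "(nat \<Rightarrow> 'a::real_normed_vector) \<Rightarrow> 'a \<Rightarrow> bool" where
  "weakly_converges u l \<longleftrightarrow>
     (\<forall>f :: 'a \<Rightarrow>\<^sub>L real. (\<lambda>n. blinfun_apply f (u n)) \<longlonglongrightarrow> blinfun_apply f l)"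

definition is_eigenvector ::
  "real \<Rightarrow> real \<Rightarrow> ('a::real_normed_vector \<Rightarrow> 'b::real_normed_vector) \<Rightarrow>
   ('a \<Rightarrow> 'a \<Rightarrow>\<^sub>L real) \<Rightarrow> ('b \<Rightarrow> 'b \<Rightarrow>\<^sub>L real) \<Rightarrow> real \<Rightarrow> 'a \<Rightarrow> bool" where
  "is_eigenvector p q \<iota> A B l w \<longleftrightarrow>
     w \<noteq> 0 \<and>
     (\<forall>v. blinfun_apply (A w) v
            = l * norm (\<iota> w) powr (p - q) * blinfun_apply (B (\<iota> w)) (\<iota> v))"

definition is_eigenvalue ::
  "real \<Rightarrow> real \<Rightarrow> ('a::real_normed_vector \<Rightarrow> 'b::real_normed_vector) \<Rightarrow>
   ('a \<Rightarrow> 'a \<Rightarrow>\<^sub>L real) \<Rightarrow> ('b \<Rightarrow> 'b \<Rightarrow>\<^sub>L real) \<Rightarrow> real \<Rightarrow> bool" where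
  "is_eigenvalue p q \<iota> A B l \<longleftrightarrow> (\<exists>w. is_eigenvector p q \<iota> A B l w)"

end

(*
  No weak compactness is needed. Let m be the infimum of norm u over the vectors u with
  norm (\<iota> u) = 1. Along a subsequence the images of the normalized minimizing sequence
  converge in Y, so the midpoints of its members have norm close to 1 in X; uniform convexity
  then makes it a Cauchy sequence in X. For a minimizer w the vector u supplied by (AB) for
  \<iota> w gives equality in (A2) for the pair (u, w), so u is a positive multiple of w and
  homogeneity turns (AB) into the eigenvalue equation.
*)
theory Submission
  imports Defs
begin

text \<open>This is uniform convexity read contrapositively: unit vectors whose midpoint has norm
  above \<open>1 - d\<close> lie closer than \<open>e\<close>, so control of midpoints alone
  controls distances.\<close>

lemma uniformly_convex_Cauchy:
  fixes y :: "nat \<Rightarrow> 'a::real_normed_vector"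
  assumes uc: "uniformly_convex TYPE('a)"
    and unit: "\<And>n. norm (y n) = 1"
    and mid: "\<And>e. e > 0 \<Longrightarrow> \<exists>N. \<forall>i\<ge>N. \<forall>j\<ge>N. norm ((1/2) *\<^sub>R (y i + y j)) > 1 - e"
  shows "Cauchy y"
proof (rule metric_CauchyI)
  fix e :: real
  assume "e > 0"
  \<comment> \<open>Uniform convexity is stated only for separations of at most 2, the diameter of
    the unit sphere, so \<open>e\<close> is capped; distances below \<open>min e 2\<close> are in
    particular below \<open>e\<close>.\<close>
  then have "0 < min e 2 \<and> min e 2 \<le> 2" by simp
  then obtain d where "d > 0"
    and d: "\<And>u v :: 'a. norm u = 1 \<and> norm v = 1 \<and> min e 2 \<le> norm (u - v)
              \<Longrightarrow> norm ((1/2) *\<^sub>R (u + v)) \<le> 1 - d"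
    using uc unfolding uniformly_convex_def by meson
  obtain N where N: "\<And>i j. i \<ge> N \<Longrightarrow> j \<ge> N \<Longrightarrow> norm ((1/2) *\<^sub>R (y i + y j)) > 1 - d"
    using mid[OF \<open>d > 0\<close>] by blast
  have "dist (y i) (y j) < e" if "i \<ge> N" "j \<ge> N" for i j
    using N[OF that] d[of "y i" "y j"] unit by (force simp: dist_norm)
  then show "\<exists>N. \<forall>i\<ge>N. \<forall>j\<ge>N. dist (y i) (y j) < e" by blast
qed

text \<open>The lower bound by \<open>m\<close> is taken in homogeneous form because it will be
  applied to midpoints, whose images need not have norm 1. The convergence obtained is in norm, so
  both norms pass to the limit.\<close>

lemma minimizing_sequence_convergent_subseq:
  fixes \<iota> :: "'x::banach \<Rightarrow> 'y::real_normed_vector"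
  assumes uc: "uniformly_convex TYPE('x)"
    and cpt: "compact_operator \<iota>"
    and m: "m > 0" "\<And>u. m * norm (\<iota> u) \<le> norm u"
    and unit: "\<And>n. norm (\<iota> (w n)) = 1"
    and lim: "(\<lambda>n. norm (w n)) \<longlonglongrightarrow> m"
  obtains r z where "strict_mono (r :: nat \<Rightarrow> nat)" "(w \<circ> r) \<longlonglongrightarrow> z"
    "norm (\<iota> z) = 1" "norm z = m"
proof -
  have bl: "bounded_linear \<iota>" using cpt by (simp add: compact_operator_def)
  interpret \<iota>: bounded_linear \<iota> by (rule bl)
  have pos: "norm (w n) > 0" for n
    using unit[of n] \<iota>.zero by fastforce
  have "Bseq (\<lambda>n. norm (w n))" using lim by (intro convergent_imp_Bseq convergentI)
  then have "bounded (range w)"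
    by (simp add: Bseq_def flip: Bseq_eq_bounded)
  then have "compact (closure (\<iota> ` range w))"
    using cpt by (simp add: compact_operator_def)
  moreover have "\<forall>n. \<iota> (w n) \<in> closure (\<iota> ` range w)"
    by (meson closure_subset imageI rangeI subsetD)
  ultimately obtain y r where r: "strict_mono (r :: nat \<Rightarrow> nat)" and y: "(\<lambda>n. \<iota> (w (r n))) \<longlonglongrightarrow> y"
    unfolding compact_eq_seq_compact_metric seq_compact_def by (auto simp: o_def elim!: allE[of _ "\<lambda>n. \<iota> (w n)"])
  have lim_r: "(\<lambda>n. norm (w (r n))) \<longlonglongrightarrow> m"
    using LIMSEQ_subseq_LIMSEQ[OF lim r] by (simp add: o_def)
  have "(\<lambda>n. norm (\<iota> (w (r n)))) \<longlonglongrightarrow> norm y" by (intro tendsto_norm y)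
  then have norm_y: "norm y = 1"
    by (simp add: unit LIMSEQ_const_iff)
  \<comment> \<open>Uniform convexity speaks of unit vectors of X, so the members are rescaled
    there. Since their norms tend to \<open>m > 0\<close>, the images now converge to
    \<open>y /\<^sub>R m\<close>, of norm \<open>1 / m\<close>.\<close>
  define x where "x n = w (r n) /\<^sub>R norm (w (r n))" for n
  define y' where "y' = y /\<^sub>R m"
  have y': "(\<lambda>n. \<iota> (x n)) \<longlonglongrightarrow> y'"
    unfolding x_def y'_def \<iota>.scaleR
    by (intro tendsto_scaleR tendsto_inverse lim_r y) (use m in simp)
  have norm_y': "m * norm y' = 1" using m(1) norm_y by (simp add: y'_def)
  have "Cauchy x"
  proof (rule uniformly_convex_Cauchy[OF uc])
    show "norm (x n) = 1" for n using pos[of "r n"] by (simp add: x_def)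
    fix e :: real
    assume e: "e > 0"
    \<comment> \<open>The image of a midpoint is then within \<open>e / m\<close> of
      \<open>y'\<close>. Multiplying by \<open>m\<close> turns \<open>norm y'\<close> into 1 and the
      error into \<open>e\<close>, and the lower bound carries the estimate back to the midpoint in
      X.\<close>
    then obtain N where N: "\<And>n. n \<ge> N \<Longrightarrow> norm (\<iota> (x n) - y') < e / m"
      using LIMSEQ_D[OF y', of "e / m"] m(1) by auto
    have "norm ((1/2) *\<^sub>R (x i + x j)) > 1 - e" if "i \<ge> N" "j \<ge> N" for i j
    proof -
      have "y' = \<iota> ((1/2) *\<^sub>R (x i + x j)) - ((1/2) *\<^sub>R (\<iota> (x i) - y') + (1/2) *\<^sub>R (\<iota> (x j) - y'))"
        by (simp add: \<iota>.scaleR \<iota>.add algebra_simps flip: scaleR_add_left)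
      then have "norm y' \<le> norm (\<iota> ((1/2) *\<^sub>R (x i + x j)))
          + norm ((1/2) *\<^sub>R (\<iota> (x i) - y') + (1/2) *\<^sub>R (\<iota> (x j) - y'))"
        by (metis norm_triangle_ineq4)
      also have "norm ((1/2) *\<^sub>R (\<iota> (x i) - y') + (1/2) *\<^sub>R (\<iota> (x j) - y'))
          \<le> norm (\<iota> (x i) - y') / 2 + norm (\<iota> (x j) - y') / 2"
        by (rule order_trans[OF norm_triangle_ineq]) simp
      also have "\<dots> < e / m" using N[OF that(1)] N[OF that(2)] by simp
      finally have "m * norm y' < m * (norm (\<iota> ((1/2) *\<^sub>R (x i + x j))) + e / m)"
        using m(1) by simp
      then have "1 < m * norm (\<iota> ((1/2) *\<^sub>R (x i + x j))) + e"
        using m(1) norm_y' by (simp add: distrib_left)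
      then show ?thesis using m(2)[of "(1/2) *\<^sub>R (x i + x j)"] by linarith
    qed
    then show "\<exists>N. \<forall>i\<ge>N. \<forall>j\<ge>N. norm ((1/2) *\<^sub>R (x i + x j)) > 1 - e" by blast
  qed
  then obtain x' where "x \<longlonglongrightarrow> x'" by (meson Cauchy_convergent convergent_def)
  \<comment> \<open>Undoing the rescaling: the scalar factors converge to \<open>m\<close>, so the
    subsequence itself converges.\<close>
  then have "(\<lambda>n. norm (w (r n)) *\<^sub>R x n) \<longlonglongrightarrow> m *\<^sub>R x'"
    by (intro tendsto_scaleR lim_r)
  moreover have "norm (w (r n)) *\<^sub>R x n = w (r n)" for n
    using pos[of "r n"] by (simp add: x_def)
  ultimately have z: "(\<lambda>n. w (r n)) \<longlonglongrightarrow> m *\<^sub>R x'" by simp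
  have "norm (m *\<^sub>R x') = m"
    using LIMSEQ_unique[OF tendsto_norm[OF z] lim_r] .
  moreover have "\<iota> (m *\<^sub>R x') = y"
    using LIMSEQ_unique[OF \<iota>.tendsto[OF z] y] .
  ultimately show thesis using that[OF r, of "m *\<^sub>R x'"] z norm_y by (simp add: o_def)
qed

text \<open>The vector \<open>u\<close> from (AB) is tested against itself and against
  \<open>w\<close>. The first bounds the right side of (A2) at \<open>(u, w)\<close> by 1, the
  second makes the left side equal to 1.\<close>

lemma minimizer_eigen_equation:
  fixes \<iota> :: "'x::real_normed_vector \<Rightarrow> 'y::real_normed_vector"
    and A :: "'x \<Rightarrow> ('x \<Rightarrow>\<^sub>L real)"
    and B :: "'y \<Rightarrow> ('y \<Rightarrow>\<^sub>L real)"
  assumes m: "m > 0" "\<And>u. m * norm (\<iota> u) \<le> norm u"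
    and A1: "\<And>t u. A (t *\<^sub>R u) = (\<bar>t\<bar> powr (p - 2) * t) *\<^sub>R A u"
    and A2: "\<And>u v. A u v \<le> norm u powr (p - 1) * norm v"
    and A2_eq: "\<And>u v. A u v = norm u powr (p - 1) * norm v
                  \<longleftrightarrow> u = 0 \<or> v = 0 \<or> (\<exists>t>0. u = t *\<^sub>R v)"
    and B2: "\<And>u v. B u v \<le> norm u powr (q - 1) * norm v"
    and B2_diag: "\<And>u. B u u = norm u powr q"
    and AB: "\<And>y. y \<noteq> 0 \<Longrightarrow> \<exists>u. u \<noteq> 0 \<and> (\<forall>v. A u v = B y (\<iota> v))"
    and w: "norm (\<iota> w) = 1" "norm w = m"
  shows "A w v = m powr p * B (\<iota> w) (\<iota> v)"
proof -
  obtain u where u: "u \<noteq> 0" and Au: "\<And>v. A u v = B (\<iota> w) (\<iota> v)"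
    using AB[of "\<iota> w"] w by force
  have diag: "A x x = norm x powr (p - 1) * norm x" for x
  proof -
    have "\<exists>t::real>0. x = t *\<^sub>R x" by (intro exI[of _ 1]) simp
    then show ?thesis using A2_eq[of x x] by blast
  qed
  \<comment> \<open>Testing with \<open>u\<close> bounds its p-th power norm by
    \<open>norm (\<iota> u)\<close>, hence by \<open>norm u / m\<close>. Cancelling
    \<open>norm u\<close> and using \<open>norm w = m\<close> leaves the desired bound.\<close>
  have "m * (norm u powr (p - 1) * norm u) = m * B (\<iota> w) (\<iota> u)"
    using diag[of u] Au[of u] by simp
  also have "\<dots> \<le> m * norm (\<iota> u)"
    using B2[of "\<iota> w" "\<iota> u"] w m(1) by simp
  also have "\<dots> \<le> 1 * norm u" using m(2)[of u] by simp
  finally have "(m * norm u powr (p - 1)) * norm u \<le> 1 * norm u" by (simp add: mult.assoc)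
  then have "norm u powr (p - 1) * norm w \<le> 1"
    using u w by (simp add: mult.commute)
  moreover have "A u w = 1" using Au[of w] B2_diag[of "\<iota> w"] w by simp
  ultimately have "A u w = norm u powr (p - 1) * norm w"
    using A2[of u w] by linarith
  moreover have "w \<noteq> 0" using w m(1) by auto
  ultimately obtain t where t: "t > 0" "u = t *\<^sub>R w"
    using A2_eq[of u w] u by blast
  \<comment> \<open>By (A1), \<open>s\<close> is the factor with
    \<open>A u = s *\<^sub>R A w\<close>. Its value is found by testing with \<open>w\<close>, which
    gives \<open>s * m powr p = 1\<close>.\<close>
  define s where "s = \<bar>t\<bar> powr (p - 2) * t"
  have s: "s * A w v = B (\<iota> w) (\<iota> v)" for v
    using Au[of v] t A1[of t w] by (simp add: s_def scaleR_blinfun.rep_eq)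
  have "A w w = m powr p"
    using diag[of w] w m(1) powr_mult_base[of m "p - 1"] by (simp add: mult.commute)
  then have "s * m powr p = 1"
    using s[of w] B2_diag[of "\<iota> w"] w by simp
  then show ?thesis using s[of v] by (metis mult.assoc mult.commute mult_1)
qed

theorem proposition2:
  fixes \<iota> :: "'x::banach \<Rightarrow> 'y::banach"
    and A :: "'x \<Rightarrow> ('x \<Rightarrow>\<^sub>L real)"
    and B :: "'y \<Rightarrow> ('y \<Rightarrow>\<^sub>L real)"
    and p q \<mu> :: real
    and w :: "nat \<Rightarrow> 'x"
  assumes uc: "uniformly_convex TYPE('x)"
    and emb: "compact_embedding \<iota>"
    and p: "p > 1" and q: "q > 1"
    and contA: "continuous_on UNIV A" and contB: "continuous_on UNIV B"
    and A1: "\<And>t u. A (t *\<^sub>R u) = (\<bar>t\<bar> powr (p - 2) * t) *\<^sub>R A u"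
    and A2: "\<And>u v. blinfun_apply (A u) v \<le> norm u powr (p - 1) * norm v"
    and A2_eq: "\<And>u v. blinfun_apply (A u) v = norm u powr (p - 1) * norm v
                  \<longleftrightarrow> u = 0 \<or> v = 0 \<or> (\<exists>t>0. u = t *\<^sub>R v)"
    and B1: "\<And>t u. B (t *\<^sub>R u) = (\<bar>t\<bar> powr (q - 2) * t) *\<^sub>R B u"
    and B2: "\<And>u v. blinfun_apply (B u) v \<le> norm u powr (q - 1) * norm v"
    and B2_eq: "\<And>u v t. t \<ge> 0 \<Longrightarrow> u = t *\<^sub>R v
                  \<Longrightarrow> blinfun_apply (B u) v = norm u powr (q - 1) * norm v"
    and AB: "\<And>y. y \<noteq> 0 \<Longrightarrow>
               \<exists>u. u \<noteq> 0 \<and> (\<forall>v. blinfun_apply (A u) v = blinfun_apply (B y) (\<iota> v))"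
    and mu: "\<mu> = Inf {norm u powr p | u. norm (\<iota> u) = 1}"
    and w_unit: "\<And>n. norm (\<iota> (w n)) = 1"
    and w_min: "(\<lambda>n. norm (w n) powr p) \<longlonglongrightarrow> \<mu>"
  shows "(\<exists>r z. strict_mono r \<and> weakly_converges (w \<circ> r) z
            \<and> norm (\<iota> z) = 1 \<and> norm z powr p = \<mu>)
       \<and> is_eigenvalue p q \<iota> A B \<mu>
       \<and> {z. is_eigenvector p q \<iota> A B \<mu> z}
           = {c *\<^sub>R u | c u. c \<noteq> 0 \<and> norm (\<iota> u) = 1 \<and> norm u powr p = \<mu>}"
proof -
  have "bounded_linear \<iota>" and inj: "inj \<iota>" and cpt: "compact_operator \<iota>"
    using emb by (simp_all add: compact_embedding_def compact_operator_def)
  then interpret \<iota>: bounded_linear \<iota> by simp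
  have \<iota>_nz: "\<iota> u \<noteq> 0" if "u \<noteq> 0" for u
    using inj that \<iota>.zero by (metis injD)
  have Bdiag: "B u u = norm u powr q" for u
    using B2_eq[of 1 u u] powr_mult_base[of "norm u" "q - 1"] by (simp add: mult.commute)
  have Adiag: "A u u = norm u powr p" for u
  proof -
    have "\<exists>t::real>0. u = t *\<^sub>R u" by (intro exI[of _ 1]) simp
    then have "A u u = norm u powr (p - 1) * norm u" using A2_eq[of u u] by blast
    then show ?thesis using powr_mult_base[of "norm u" "p - 1"] by (simp add: mult.commute)
  qed
  obtain K where K: "K > 0" "\<And>x. norm (\<iota> x) \<le> norm x * K"
    using \<iota>.pos_bounded by blast
  \<comment> \<open>Boundedness of the embedding keeps the vectors \<open>w n\<close> away from 0 in
    X, and the bound survives in the limit; this is what makes the infimum positive.\<close>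
  have "(1 / K) powr p \<le> norm (w n) powr p" for n
    using K(1) K(2)[of "w n"] w_unit[of n] p by (intro powr_mono2) (auto simp: field_simps)
  then have "(1 / K) powr p \<le> \<mu>"
    by (intro LIMSEQ_le_const[OF w_min]) blast
  then have \<mu>_pos: "\<mu> > 0"
    by (rule less_le_trans[rotated]) (use K(1) in simp)
  define m where "m = \<mu> powr (1 / p)"
  have m_pos: "m > 0" and m_powr: "m powr p = \<mu>"
    using \<mu>_pos p by (simp_all add: m_def powr_powr)
  have root: "(norm u powr p) powr (1 / p) = norm u" for u :: 'x
    using p by (simp add: powr_powr)
  have m_iff: "norm u powr p = \<mu> \<longleftrightarrow> norm u = m" for u :: 'x
    using root[of u] m_powr by (auto simp: m_def)
  have bdd: "bdd_below {norm u powr p | u. norm (\<iota> u) = 1}"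
    by (intro bdd_belowI[of _ 0]) auto
  have m_unit: "m \<le> norm u" if "norm (\<iota> u) = 1" for u
  proof -
    have "\<mu> \<le> norm u powr p"
      unfolding mu using that by (intro cInf_lower bdd) auto
    then have "m \<le> (norm u powr p) powr (1 / p)"
      unfolding m_def using \<mu>_pos p by (intro powr_mono2) auto
    then show ?thesis by (simp add: root)
  qed
  \<comment> \<open>The bound on the unit sphere of Y extends to all of X by scaling; injectivity of
    the embedding allows the division by \<open>norm (\<iota> u)\<close>.\<close>
  have m_le: "m * norm (\<iota> u) \<le> norm u" for u
  proof (cases "u = 0")
    case False
    then have "norm (\<iota> (u /\<^sub>R norm (\<iota> u))) = 1" using \<iota>_nz[of u] by (simp add: \<iota>.scaleR)
    from m_unit[OF this] show ?thesis using \<iota>_nz[OF False] by (simp add: field_simps)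
  qed (simp add: \<iota>.zero)
  have "(\<lambda>n. (norm (w n) powr p) powr (1 / p)) \<longlonglongrightarrow> \<mu> powr (1 / p)"
    using \<mu>_pos by (intro tendsto_powr w_min tendsto_const) auto
  then have "(\<lambda>n. norm (w n)) \<longlonglongrightarrow> m" by (simp add: root m_def)
  then obtain r z where r: "strict_mono (r :: nat \<Rightarrow> nat)" and z: "(w \<circ> r) \<longlonglongrightarrow> z"
    and z1: "norm (\<iota> z) = 1" and zm: "norm z = m"
    by (rule minimizing_sequence_convergent_subseq[where w = w, OF uc cpt m_pos m_le w_unit])
  have "weakly_converges (w \<circ> r) z"
    unfolding weakly_converges_def using z by (intro allI blinfun.tendsto tendsto_const)
  with r z1 zm m_iff have
    first: "\<exists>r z. strict_mono r \<and> weakly_converges (w \<circ> r) z \<and> norm (\<iota> z) = 1 \<and> norm z powr p = \<mu>"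
    by blast
  have eigen: "is_eigenvector p q \<iota> A B \<mu> (c *\<^sub>R u)"
    if "c \<noteq> 0" "norm (\<iota> u) = 1" "norm u = m" for c u
    unfolding is_eigenvector_def
  proof (intro conjI allI)
    show "c *\<^sub>R u \<noteq> 0" using that m_pos by auto
    fix v
    have "A u v = \<mu> * B (\<iota> u) (\<iota> v)"
      using minimizer_eigen_equation[of m \<iota> A p B q u v] m_pos m_le A1 A2 A2_eq B2 Bdiag AB that m_powr
      by blast
    \<comment> \<open>Both sides of the eigenvalue equation are homogeneous of the same degree: the
      factor \<open>norm (\<iota> w) powr (p - q)\<close> compensates for the different exponents in
      (A1) and (B1).\<close>
    moreover have "\<bar>c\<bar> powr (p - q) * \<bar>c\<bar> powr (q - 2) = \<bar>c\<bar> powr (p - 2)"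
      by (simp flip: powr_add)
    ultimately show "A (c *\<^sub>R u) v = \<mu> * norm (\<iota> (c *\<^sub>R u)) powr (p - q) * B (\<iota> (c *\<^sub>R u)) (\<iota> v)"
      using that(2) by (simp add: A1 B1 \<iota>.scaleR scaleR_blinfun.rep_eq)
  qed
  have conv: "\<exists>c u. x = c *\<^sub>R u \<and> c \<noteq> 0 \<and> norm (\<iota> u) = 1 \<and> norm u powr p = \<mu>"
    if "is_eigenvector p q \<iota> A B \<mu> x" for x
  proof -
    have nz: "norm (\<iota> x) > 0" using that \<iota>_nz by (simp add: is_eigenvector_def)
    \<comment> \<open>Testing the equation with the eigenvector itself shows that its Rayleigh
      quotient is the infimum, so normalizing it in Y gives a minimizer.\<close>
    have "norm x powr p = \<mu> * norm (\<iota> x) powr (p - q) * norm (\<iota> x) powr q"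
      using that Adiag[of x] Bdiag[of "\<iota> x"] by (simp add: is_eigenvector_def)
    also have "\<dots> = \<mu> * norm (\<iota> x) powr p"
      by (simp add: mult.assoc flip: powr_add)
    finally have "norm (x /\<^sub>R norm (\<iota> x)) powr p = \<mu>"
      using nz by (simp add: powr_divide divide_simps)
    moreover have "norm (\<iota> (x /\<^sub>R norm (\<iota> x))) = 1" using nz by (simp add: \<iota>.scaleR)
    moreover have "x = norm (\<iota> x) *\<^sub>R (x /\<^sub>R norm (\<iota> x))" using nz by simp
    ultimately show ?thesis using nz by (metis less_irrefl)
  qed
  have "is_eigenvalue p q \<iota> A B \<mu>"
    unfolding is_eigenvalue_def using eigen[OF _ z1 zm, of 1] by fastforce
  moreover have "{z. is_eigenvector p q \<iota> A B \<mu> z}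
      = {c *\<^sub>R u | c u. c \<noteq> 0 \<and> norm (\<iota> u) = 1 \<and> norm u powr p = \<mu>}"
    using eigen conv m_iff by fast
  ultimately show ?thesis using first by simp
qed

end
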